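(* Let $d\ge2$ be an integer, let $1^*=\frac{d}{d-1}$, let $1\le q\le r<\infty$ and $\beta\in\mathbb{R}$, and let $\theta\in(0,1]$ be the solution of $$\frac1r=\frac{\theta}{q}+\frac{1-\theta}{r+1^*}.$$ There is a constant $C$ depending only on $d,q,r,\beta$ such that for every $\tau>0$ and every smooth compactly supported function $u$ on $\Sigma_\tau\cong\mathbb{R}^d$, $$\left(\tau^{1/d}\right)^{\frac{r-q}{r}}\|u\|_{\mathcal{L}^r_{1+\theta\beta r}}\le C\left(\|u\|_{\mathcal{L}^q_{1+\beta q}}\right)^{q/r}\left(\|u\|_{\mathring{\mathcal{W}}^{1,d}_{(1-d)(1+\beta\theta r)}}\right)^{(r-q)/r}.$$
   Context: For $\tau>0$ let $\Sigma_\tau=\{(t,x)\in\mathbb{R}^{1+d}: t^2-|x|^2=\tau^2,\ t>0\}$, parametrized by $x\in\mathbb{R}^d$ via $x\mapsto(\sqrt{\tau^2+|x|^2},x)$, and let $w_\tau(x)=\sqrt{\tau^2+|x|^2}$. The induced volume form is $\mathrm{dvol}=\frac{\tau}{w_\tau}\,dx^1\cdots dx^d$. The Lorentz boosts $L^i=x^i\partial_t+t\partial_{x^i}$ are tangent to $\Sigma_\tau$ and act there as $L^i=w_\tau\partial_{x^i}$. For $p\in[1,\infty)$, $\alpha\in\mathbb{R}$, $k\in\mathbb{N}$: $\|u\|_{\mathcal{L}^p_\alpha}=\left(\int_{\Sigma_\tau} w_\tau^\alpha|u|^p\,\mathrm{dvol}\right)^{1/p}$ and $\|u\|_{\mathring{\mathcal{W}}^{k,p}_\alpha}=\sum_{i_1,\dots,i_k=1}^d\|L^{i_1}\cdots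 L^{i_k}u\|_{\mathcal{L}^p_\alpha}$. *)

theory Defs
  imports "HOL-Analysis.Analysis"
begin

text \<open>
  Functions on the hyperboloid \<open>\<Sigma>\<^sub>\<tau> = {(t, x). t\<^sup>2 - |x|\<^sup>2 = \<tau>\<^sup>2 \<and> t > 0}\<close> in \<open>\<real>\<close>\<open>\<^sup>1\<^sup>+\<^sup>d\<close> are
  represented in the global chart \<open>x \<mapsto> (w\<^sub>\<tau>(x), x)\<close>, that is, as functions on
  \<^typ>\<open>real ^ 'n\<close> with \<open>d = CARD('n)\<close>.
\<close>

definition hyp_w :: "real \<Rightarrow> real ^ 'n \<Rightarrow> real" where
  "hyp_w \<tau> x = sqrt (\<tau>\<^sup>2 + (norm x)\<^sup>2)"

text \<open>The volume measure that the Minkowski metric induces on \<open>\<Sigma>\<^sub>\<tau>\<close>, written in the chart.\<close>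

definition hyp_vol :: "real \<Rightarrow> (real ^ 'n) measure" where
  "hyp_vol \<tau> = density lborel (\<lambda>x. ennreal (\<tau> / hyp_w \<tau> x))"

definition partial_deriv :: "'n \<Rightarrow> (real ^ 'n \<Rightarrow> real) \<Rightarrow> real ^ 'n \<Rightarrow> real" where
  "partial_deriv i u x = frechet_derivative u (at x) (axis i 1)"

text \<open>
  The Lorentz boost \<open>L\<^sup>i = x\<^sup>i \<partial>\<^sub>t + t \<partial>\<^sub>i\<close> is tangent to \<open>\<Sigma>\<^sub>\<tau>\<close>. By the chain rule, it sends the
  restriction \<open>u(x) = F(w\<^sub>\<tau>(x), x)\<close> of an ambient function \<open>F\<close> to \<open>w\<^sub>\<tau> \<partial>\<^sub>i u\<close>, since
  \<open>\<partial>\<^sub>i w\<^sub>\<tau> = x\<^sup>i / w\<^sub>\<tau>\<close>.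
\<close>

definition boost :: "real \<Rightarrow> 'n \<Rightarrow> (real ^ 'n \<Rightarrow> real) \<Rightarrow> real ^ 'n \<Rightarrow> real" where
  "boost \<tau> i u x = hyp_w \<tau> x * partial_deriv i u x"

definition Lp_norm :: "real \<Rightarrow> real \<Rightarrow> real \<Rightarrow> (real ^ 'n \<Rightarrow> real) \<Rightarrow> real" where
  "Lp_norm \<tau> p \<alpha> u =
     (\<integral>x. hyp_w \<tau> x powr \<alpha> * \<bar>u x\<bar> powr p \<partial>hyp_vol \<tau>) powr (1 / p)"

text \<open>The multi-indices \<open>(i\<^sub>1, \<dots>, i\<^sub>k)\<close> are the lists of length \<open>k\<close>; \<open>foldr\<close> applies \<open>L\<close> with
  index \<open>i\<^sub>k\<close> first.\<close>

definition W_norm :: "real \<Rightarrow> nat \<Rightarrow> real \<Rightarrow> real \<Rightarrow> (real ^ 'n \<Rightarrow> real) \<Rightarrow> real" where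
  "W_norm \<tau> k p \<alpha> u =
     (\<Sum>I\<in>{I :: 'n list. length I = k}. Lp_norm \<tau> p \<alpha> (foldr (boost \<tau>) I u))"

primrec C_k :: "nat \<Rightarrow> (real ^ 'n \<Rightarrow> real) \<Rightarrow> bool" where
  "C_k 0 u \<longleftrightarrow> continuous_on UNIV u"
| "C_k (Suc k) u \<longleftrightarrow> (\<forall>x. u differentiable (at x)) \<and> (\<forall>i. C_k k (partial_deriv i u))"

definition smooth :: "(real ^ 'n \<Rightarrow> real) \<Rightarrow> bool" where
  "smooth u \<longleftrightarrow> (\<forall>k. C_k k u)"

definition compactly_supported :: "(real ^ 'n \<Rightarrow> real) \<Rightarrow> bool" where
  "compactly_supported u \<longleftrightarrow> compact (closure {x. u x \<noteq> 0})"

end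

theory Submission
  imports Defs
begin

text \<open>
  In the chart, every norm is a power of \<open>\<tau>\<close> times a norm for a weighted Lebesgue measure on
  \<open>\<real>\<^sup>d\<close>, with weights that are powers of \<open>w = w\<^sub>\<tau>\<close>. The powers of \<open>\<tau>\<close> on the two sides of the inequality
  agree. Put \<open>\<gamma> = \<theta> \<beta> r\<close> and
    \<open>A = \<integral> w\<^sup>\<gamma> |u|\<^sup>r\<close>, \<open>B = \<integral> w powr (\<beta> q) |u|\<^sup>q\<close> and
    \<open>G = \<Sum>\<^sub>i (\<integral> w powr ((1 - d) \<gamma>) |\<partial>\<^sub>i u|\<^sup>d) powr (1 / d)\<close>.
  What has to be shown is \<open>A \<le> C B G powr (r - q)\<close>, where \<open>C\<close> depends only on \<open>d\<close>, \<open>q\<close>, \<open>r\<close> and \<open>\<theta>\<close>. Of the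
  weight, continuity and positivity are used.

  Two estimates are combined, with \<open>\<sigma> = d / (d - 1)\<close>. The first is the Sobolev embedding of
  \<open>W\<close> with exponent \<open>1\<close> into \<open>L\<close> with exponent \<open>\<sigma>\<close>, for the function \<open>|u| powr s\<close> with
  \<open>s = 1 + r / \<sigma>\<close>. Its gradient is bounded by \<open>s |u| powr (r / \<sigma>) |\<partial> u|\<close>, and Hoelder's inequality
  splits off \<open>w\<^sup>\<gamma> |u|\<^sup>r\<close> to the power \<open>1 / \<sigma>\<close>. The weights attached to the two factors are inverse
  to each other, so that no derivative falls on a weight. The result is
  \<open>\<integral> |u| powr (r + \<sigma>) \<le> C A G powr \<sigma>\<close> (\<open>moment_le_moment_energy\<close>). The second is the
  interpolation \<open>A \<le> B\<^sup>l (\<integral> |u| powr (r + \<sigma>)) powr (1 - l)\<close> with \<open>l = \<theta> r / q\<close>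
  (\<open>moment_interpolation\<close>), which is Hoelder's inequality for the exponents in the equation defining
  \<open>\<theta>\<close>. Inserting the first into the second and dividing by the power of \<open>A\<close> gives the claim
  (\<open>weighted_gagliardo_nirenberg\<close>).

  The Sobolev embedding itself (\<open>gagliardo_nirenberg_sobolev\<close>) is Gagliardo's argument: \<open>|f|\<^sup>d\<close> is at most
  the product over the coordinate directions of the integrals of the partial derivatives over lines,
  and this product is integrated one coordinate after the other. Carried out for functions with
  values in \<open>[0, \<infinity>]\<close> and with \<open>(d - 1)\<close>-th powers in place of roots, the
  argument becomes an induction on the set of coordinates integrated so far
  (\<open>fibre_integral_power_le\<close>).
\<close>

section \<open>A Hoelder inequality with integer exponents\<close>

text \<open>
  After division by the mean every factor satisfies \<open>t \<le> exp (t - 1)\<close>, and the exponents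
  \<open>t - 1\<close> sum to zero.
\<close>

lemma prod_le_power_mean:
  fixes a :: "'i \<Rightarrow> real"
  assumes "finite I" and nonneg: "\<And>i. i \<in> I \<Longrightarrow> 0 \<le> a i"
  shows "(\<Prod>i\<in>I. a i) \<le> ((\<Sum>i\<in>I. a i) / real (card I)) ^ card I"
proof (cases "(\<Sum>i\<in>I. a i) = 0")
  case True
  then have z: "\<forall>i\<in>I. a i = 0"
    using assms by (simp add: sum_nonneg_eq_0_iff)
  then have "(\<Prod>i\<in>I. a i) = 0 ^ card I" by simp
  then show ?thesis using True by simp
next
  case False
  define S where "S = (\<Sum>i\<in>I. a i) / real (card I)"
  have "I \<noteq> {}" using False by auto
  then have card: "card I > 0" using assms by auto
  have "(\<Sum>i\<in>I. a i) > 0" using False nonneg by (metis sum_nonneg order_le_less)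
  then have S: "S > 0" using card by (simp add: S_def)
  have "(\<Prod>i\<in>I. a i / S) \<le> (\<Prod>i\<in>I. exp (a i / S - 1))"
    using nonneg S exp_ge_add_one_self[of "_ - 1"]
    by (intro prod_mono) (auto simp: algebra_simps)
  also have "\<dots> = exp ((\<Sum>i\<in>I. a i) / S - real (card I))"
    using assms(1) by (simp add: exp_sum[symmetric] sum_subtractf sum_divide_distrib)
  also have "(\<Sum>i\<in>I. a i) / S = real (card I)"
    using card False by (simp add: S_def)
  finally have "(\<Prod>i\<in>I. a i) / S ^ card I \<le> 1"
    by (simp add: prod_dividef)
  then show ?thesis using S by (simp add: S_def[symmetric] divide_le_eq)
qed

text \<open>
  This is the generalised Hoelder inequality for \<open>m = card I\<close> functions with all exponents equal
  to \<open>m\<close>. Stating it with \<open>m\<close>-th powers on both sides, instead of \<open>m\<close>-th roots of the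
  functions \<open>A i\<close>, keeps everything inside the arithmetic of \<open>[0, \<infinity>]\<close>. When all the integrals
  \<open>\<alpha> i\<close> of the \<open>A i\<close> are positive and finite, the inequality of arithmetic and geometric means for
  the normalised functions \<open>A i / \<alpha> i\<close> bounds \<open>F\<close> pointwise by a multiple of their sum, and
  this bound is integrated.
\<close>

lemma nn_integral_power_le_prod:
  fixes F :: "'a \<Rightarrow> ennreal" and A :: "'i \<Rightarrow> 'a \<Rightarrow> ennreal"
  assumes fin: "finite I" and ne: "I \<noteq> {}"
    and F [measurable]: "F \<in> borel_measurable M"
    and A [measurable]: "\<And>i. i \<in> I \<Longrightarrow> A i \<in> borel_measurable M"
    and le: "\<And>x. x \<in> space M \<Longrightarrow> F x ^ card I \<le> (\<Prod>i\<in>I. A i x)"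
  shows "(\<integral>\<^sup>+x. F x \<partial>M) ^ card I \<le> (\<Prod>i\<in>I. \<integral>\<^sup>+x. A i x \<partial>M)"
proof -
  define m where "m = card I"
  have m: "m > 0" using fin ne by (simp add: m_def card_gt_0_iff)
  define \<alpha> where "\<alpha> i = (\<integral>\<^sup>+x. A i x \<partial>M)" for i
  consider (zero) i where "i \<in> I" "\<alpha> i = 0"
    | (top) i where "\<And>i. i \<in> I \<Longrightarrow> \<alpha> i \<noteq> 0" "i \<in> I" "\<alpha> i = top"
    | (fin) "\<And>i. i \<in> I \<Longrightarrow> \<alpha> i \<noteq> 0" "\<And>i. i \<in> I \<Longrightarrow> \<alpha> i \<noteq> top"
    by blast
  then show ?thesis
  proof cases
    case zero
    have "AE x in M. A i x = 0"
      using zero by (simp add: \<alpha>_def nn_integral_0_iff_AE)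
    then have "AE x in M. F x = 0"
    proof (rule AE_mp, intro AE_I2 impI)
      fix x assume "x \<in> space M" "A i x = 0"
      then have "(\<Prod>i\<in>I. A i x) = 0" using zero fin by (intro prod_zero) auto
      then have "F x ^ m = 0" using le[OF \<open>x \<in> space M\<close>] unfolding m_def by (metis le_zero_eq)
      then show "F x = 0" using m by auto
    qed
    then have "(\<integral>\<^sup>+x. F x \<partial>M) = 0" by (simp add: nn_integral_0_iff_AE)
    then show ?thesis using m by (simp add: m_def[symmetric] zero_power)
  next
    case top
    have "(\<Prod>i\<in>I. \<alpha> i) = top"
      using top fin by (auto simp: ennreal_prod_eq_top)
    then show ?thesis by (simp add: \<alpha>_def)
  next
    case fin
    define c where "c i = enn2real (\<alpha> i)" for i
    have c: "\<alpha> i = ennreal (c i)" "c i > 0" if "i \<in> I" for i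
      using fin[OF that] by (auto simp: c_def enn2real_positive_iff less_top zero_less_iff_neq_zero)
    define K where "K = root m (\<Prod>i\<in>I. c i)"
    have K: "K > 0" "K ^ m = (\<Prod>i\<in>I. c i)"
      using m c by (auto simp: K_def prod_pos prod_nonneg less_imp_le)
    have pt: "F x \<le> (\<Sum>i\<in>I. ennreal (K / (m * c i)) * A i x)" if x: "x \<in> space M" for x
    proof (cases "\<exists>i\<in>I. A i x = top")
      case True
      then obtain i where i: "i \<in> I" "A i x = top" by blast
      then have "ennreal (K / (m * c i)) * A i x = top"
        using K c[OF i(1)] m by (simp add: ennreal_mult_eq_top_iff)
      then have "(\<Sum>i\<in>I. ennreal (K / (m * c i)) * A i x) = top"
        using i assms(1) by (auto simp: ennreal_sum_eq_top intro!: bexI[of _ i])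
      then show ?thesis by simp
    next
      case False
      define a where "a i = enn2real (A i x)" for i
      have a: "A i x = ennreal (a i)" "a i \<ge> 0" if "i \<in> I" for i
        using False that by (auto simp: a_def less_top)
      have pr: "(\<Prod>i\<in>I. A i x) = ennreal (\<Prod>i\<in>I. a i)"
        using a by (simp add: prod_ennreal)
      then have "F x ^ m < top"
        using le[OF x] by (simp add: m_def le_less_trans)
      then have "F x < top" using m by (auto simp: power_less_top_ennreal)
      then obtain f where f: "F x = ennreal f" "f \<ge> 0" by (cases "F x") auto
      have "f ^ m \<le> (\<Prod>i\<in>I. a i)"
        using le[OF x] f a pr by (simp add: m_def ennreal_power prod_nonneg)
      then have "(f / K) ^ m \<le> (\<Prod>i\<in>I. a i / c i)"
        using K by (simp add: power_divide prod_dividef divide_right_mono prod_nonneg c less_imp_le)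
      also have "\<dots> \<le> ((\<Sum>i\<in>I. a i / c i) / m) ^ m"
        unfolding m_def using assms(1) a c by (intro prod_le_power_mean) (auto simp: less_imp_le)
      finally have pw: "(f / K) ^ m \<le> ((\<Sum>i\<in>I. a i / c i) / m) ^ m" .
      have "0 \<le> (\<Sum>i\<in>I. a i / c i) / m"
        using a c by (intro divide_nonneg_nonneg sum_nonneg) (auto simp: less_imp_le)
      then have "f / K \<le> (\<Sum>i\<in>I. a i / c i) / m"
        using pw m by (intro power_le_imp_le_base[of "f / K" "m - 1"]) simp_all
      then have "f \<le> K * ((\<Sum>i\<in>I. a i / c i) / m)"
        using K by (simp add: field_simps)
      also have "\<dots> = (\<Sum>i\<in>I. K / (m * c i) * a i)"
        by (simp add: sum_distrib_left sum_divide_distrib field_simps)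
      finally have "F x \<le> ennreal (\<Sum>i\<in>I. K / (m * c i) * a i)"
        using f by (simp add: ennreal_leI)
      also have "\<dots> = (\<Sum>i\<in>I. ennreal (K / (m * c i) * a i))"
        using K m a c by (subst sum_ennreal) (auto simp: less_imp_le)
      also have "\<dots> = (\<Sum>i\<in>I. ennreal (K / (m * c i)) * A i x)"
        using K m a c by (intro sum.cong) (auto simp: ennreal_mult[symmetric] less_imp_le)
      finally show ?thesis .
    qed
    have "(\<integral>\<^sup>+x. F x \<partial>M) \<le> (\<integral>\<^sup>+x. (\<Sum>i\<in>I. ennreal (K / (m * c i)) * A i x) \<partial>M)"
      by (intro nn_integral_mono pt)
    also have "\<dots> = (\<Sum>i\<in>I. ennreal (K / (m * c i)) * \<alpha> i)"
      by (simp add: nn_integral_sum nn_integral_cmult \<alpha>_def)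
    also have "\<dots> = (\<Sum>i\<in>I. ennreal (K / m))"
      using c K m less_imp_neq[OF c(2)]
      by (intro sum.cong) (force simp: ennreal_mult[symmetric] less_imp_le)+
    also have "\<dots> = ennreal K"
      using m K by (simp add: m_def[symmetric] ennreal_of_nat_eq_real_of_nat ennreal_mult[symmetric])
    finally have "(\<integral>\<^sup>+x. F x \<partial>M) ^ m \<le> ennreal K ^ m"
      by (intro power_mono) auto
    also have "\<dots> = (\<Prod>i\<in>I. \<alpha> i)"
      using K c by (simp add: ennreal_power prod_ennreal[symmetric] less_imp_le)
    finally show ?thesis by (simp add: \<alpha>_def m_def)
  qed
qed

section \<open>Integrating out a set of coordinates\<close>

text \<open>
  The coordinates in \<open>S\<close> are integrated out, those outside \<open>S\<close> are read off from \<open>x\<close>. The result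
  remains a function on the whole space, constant in the directions of \<open>S\<close>, so that integrals
  over different sets of coordinates can be multiplied pointwise.
\<close>

definition fibre_integral :: "'a::euclidean_space set \<Rightarrow> ('a \<Rightarrow> ennreal) \<Rightarrow> 'a \<Rightarrow> ennreal" where
  "fibre_integral S g x =
    (\<integral>\<^sup>+y. g (\<Sum>b\<in>Basis. (if b \<in> S then y b else x \<bullet> b) *\<^sub>R b) \<partial>Pi\<^sub>M S (\<lambda>_. lborel))"

lemma fibre_coords_measurable:
  fixes S :: "'a::euclidean_space set"
  shows "(\<lambda>(x, y). \<Sum>b\<in>Basis. (if b \<in> S then y b else x \<bullet> b) *\<^sub>R b)
     \<in> measurable ((borel :: 'a measure) \<Otimes>\<^sub>M Pi\<^sub>M S (\<lambda>_. lborel :: real measure)) borel"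
proof -
  have "(\<lambda>p. (if b \<in> S then snd p b else fst p \<bullet> b) *\<^sub>R b)
     \<in> measurable ((borel :: 'a measure) \<Otimes>\<^sub>M Pi\<^sub>M S (\<lambda>_. lborel :: real measure)) borel" for b :: 'a
    by (cases "b \<in> S"; simp; measurable)
  then show ?thesis by (simp add: case_prod_beta)
qed

lemma fibre_integral_measurable:
  fixes S :: "'a::euclidean_space set"
  assumes [measurable]: "g \<in> borel_measurable borel" and S: "S \<subseteq> Basis"
  shows "fibre_integral S g \<in> borel_measurable borel"
proof -
  interpret product_sigma_finite "\<lambda>_::'a. lborel :: real measure" by standard
  interpret finite_product_sigma_finite "\<lambda>_::'a. lborel :: real measure" S
    by standard (use S in \<open>auto intro: finite_subset[OF _ finite_Basis]\<close>)
  have "(\<lambda>(x, y). g (\<Sum>b\<in>Basis. (if b \<in> S then y b else x \<bullet> b) *\<^sub>R b))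
      \<in> borel_measurable ((borel :: 'a measure) \<Otimes>\<^sub>M Pi\<^sub>M S (\<lambda>_. lborel :: real measure))"
    using measurable_compose[OF fibre_coords_measurable assms(1)] by (simp add: case_prod_beta)
  from borel_measurable_nn_integral[OF this]
  show ?thesis unfolding fibre_integral_def[abs_def] .
qed

lemma fibre_integral_empty [simp]:
  fixes x :: "'a::euclidean_space"
  shows "fibre_integral {} g x = g x"
proof -
  interpret product_sigma_finite "\<lambda>_::'a. lborel :: real measure" by standard
  show ?thesis
    unfolding fibre_integral_def by (subst nn_integral_empty) (simp_all add: euclidean_representation)
qed

lemma fibre_integral_Basis:
  fixes g :: "'a::euclidean_space \<Rightarrow> ennreal"
  assumes [measurable]: "g \<in> borel_measurable borel"
  shows "fibre_integral Basis g x = (\<integral>\<^sup>+x. g x \<partial>lborel)"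
proof -
  have "(\<integral>\<^sup>+x. g x \<partial>lborel) = (\<integral>\<^sup>+y. g (\<Sum>b\<in>Basis. y b *\<^sub>R b) \<partial>(\<Pi>\<^sub>M b\<in>(Basis::'a set). lborel))"
    by (subst lborel_eq) (simp add: nn_integral_distr)
  then show ?thesis by (simp add: fibre_integral_def)
qed

text \<open>
  By Fubini, integrating out one more coordinate \<open>j\<close> is an integration over the line through
  \<open>x\<close> in direction \<open>j\<close>, which is parametrised here by the value \<open>t\<close> of the coordinate \<open>j\<close>.
\<close>

lemma fibre_integral_insert:
  fixes g :: "'a::euclidean_space \<Rightarrow> ennreal"
  assumes [measurable]: "g \<in> borel_measurable borel"
    and S: "insert j S \<subseteq> Basis" "j \<notin> S"
  shows "fibre_integral (insert j S) g x = (\<integral>\<^sup>+t. fibre_integral S g (x + (t - x \<bullet> j) *\<^sub>R j) \<partial>lborel)"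
proof -
  interpret product_sigma_finite "\<lambda>_::'a. lborel :: real measure" by standard
  have [simp]: "finite S" using S by (auto intro: finite_subset[OF _ finite_Basis])
  have j: "j \<in> Basis" using S by simp
  have "(\<lambda>y. g (\<Sum>b\<in>Basis. (if b \<in> insert j S then y b else x \<bullet> b) *\<^sub>R b))
      \<in> borel_measurable (Pi\<^sub>M (insert j S) (\<lambda>_. lborel))"
    using measurable_compose[OF measurable_Pair1' fibre_coords_measurable[of "insert j S"], of x]
    by (intro measurable_compose[OF _ assms(1)]) simp
  then have "fibre_integral (insert j S) g x = (\<integral>\<^sup>+t. \<integral>\<^sup>+y.
      g (\<Sum>b\<in>Basis. (if b \<in> insert j S then (y(j := t)) b else x \<bullet> b) *\<^sub>R b) \<partial>Pi\<^sub>M S (\<lambda>_. lborel) \<partial>lborel)"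
    unfolding fibre_integral_def using S by (subst product_nn_integral_insert_rev) auto
  also have "\<dots> = (\<integral>\<^sup>+t. fibre_integral S g (x + (t - x \<bullet> j) *\<^sub>R j) \<partial>lborel)"
    unfolding fibre_integral_def
    using S j by (intro nn_integral_cong arg_cong[of _ _ g] sum.cong)
      (auto simp: inner_add_left inner_Basis)
  finally show ?thesis .
qed

lemma fibre_integral_shift:
  assumes "j \<in> S" "S \<subseteq> Basis"
  shows "fibre_integral S g (x + c *\<^sub>R j) = fibre_integral S g x"
  unfolding fibre_integral_def
  using assms by (intro nn_integral_cong arg_cong[of _ _ g] sum.cong)
    (auto simp: inner_add_left inner_Basis)

text \<open>
  Induction on \<open>S\<close>. When \<open>j\<close> is added, the factor with index \<open>j\<close> on the right-hand side does not depend on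
  the coordinate \<open>j\<close> any more. What remains are exactly \<open>d - 1\<close> factors, as many as the exponent, and
  Hoelder's inequality in the variable \<open>j\<close> turns each of them into its integral over that
  variable.
\<close>

lemma fibre_integral_power_le:
  fixes F :: "'a::euclidean_space \<Rightarrow> ennreal" and G :: "'a \<Rightarrow> 'a \<Rightarrow> ennreal"
  assumes dim: "DIM('a) \<ge> 2"
    and F [measurable]: "F \<in> borel_measurable borel"
    and G [measurable]: "\<And>i. i \<in> Basis \<Longrightarrow> G i \<in> borel_measurable borel"
    and le: "\<And>x. F x ^ (DIM('a) - 1) \<le> (\<Prod>i\<in>Basis. fibre_integral {i} (G i) x)"
    and S: "S \<subseteq> Basis"
  shows "fibre_integral S F x ^ (DIM('a) - 1) \<le> (\<Prod>i\<in>Basis. fibre_integral (insert i S) (G i) x)"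
proof -
  have "finite S" using S by (auto intro: finite_subset[OF _ finite_Basis])
  then show ?thesis using S
  proof (induction S arbitrary: x rule: finite_induct)
    case empty
    show ?case using le by simp
  next
    case (insert j S)
    let ?I = "Basis - {j}" and ?m = "DIM('a) - 1"
    have j: "j \<in> Basis" and S: "S \<subseteq> Basis" using insert by auto
    have card: "card ?I = ?m" using j by simp
    have "?m > 0" using dim by simp
    then have ne: "?I \<noteq> {}" using card by (metis card.empty less_irrefl)
    then obtain k where k: "k \<in> ?I" by blast
    define p where "p t = x + (t - x \<bullet> j) *\<^sub>R j" for t
    have [measurable]: "p \<in> borel_measurable borel" by (simp add: p_def[abs_def])
    define c where "c = fibre_integral (insert j S) (G j) x"
    \<comment> \<open>The factor \<open>c\<close> is constant along the line; it is attached to one of the others, with index \<open>k\<close>,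
      so that Hoelder's inequality sees only the factors with index in \<open>?I\<close>.\<close>
    define A where "A i t = (if i = k then c else 1) * fibre_integral (insert i S) (G i) (p t)" for i t
    have cc: "(\<Prod>i\<in>?I. (if i = k then c else 1) * h i) = c * (\<Prod>i\<in>?I. h i)" for h :: "'a \<Rightarrow> ennreal"
      using k by (simp add: prod.distrib prod.delta)
    have G': "fibre_integral (insert i S) (G i) \<in> borel_measurable borel" if "i \<in> Basis" for i
      using that S by (intro fibre_integral_measurable G) auto
    have [measurable]: "fibre_integral S F \<in> borel_measurable borel"
      using S by (intro fibre_integral_measurable) auto
    have Gp: "(\<lambda>t. fibre_integral (insert i S) (G i) (p t)) \<in> borel_measurable borel" if "i \<in> Basis" for i
      using G'[OF that] by measurable
    have "fibre_integral (insert j S) F x ^ ?m = (\<integral>\<^sup>+t. fibre_integral S F (p t) \<partial>lborel) ^ card ?I"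
      using fibre_integral_insert[OF F insert.prems insert.hyps(2), of x] unfolding card p_def by simp
    also have "\<dots> \<le> (\<Prod>i\<in>?I. \<integral>\<^sup>+t. A i t \<partial>lborel)"
    proof (rule nn_integral_power_le_prod)
      show "A i \<in> borel_measurable lborel" if "i \<in> ?I" for i
        unfolding A_def measurable_lborel2
        by (rule borel_measurable_times_ennreal[OF borel_measurable_const Gp]) (use that in simp)
      fix t
      have "fibre_integral S F (p t) ^ card ?I \<le> (\<Prod>i\<in>Basis. fibre_integral (insert i S) (G i) (p t))"
        using insert.IH[OF S] card by simp
      also have "\<dots> = c * (\<Prod>i\<in>?I. fibre_integral (insert i S) (G i) (p t))"
        using j insert.prems by (subst prod.remove[of _ j])
          (auto simp: c_def p_def fibre_integral_shift)
      also have "\<dots> = (\<Prod>i\<in>?I. A i t)"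
        unfolding A_def by (rule cc[symmetric])
      finally show "fibre_integral S F (p t) ^ card ?I \<le> (\<Prod>i\<in>?I. A i t)" .
    qed (use ne in auto)
    also have "\<dots> = (\<Prod>i\<in>?I. (if i = k then c else 1) * fibre_integral (insert i (insert j S)) (G i) x)"
    proof (rule prod.cong[OF refl])
      fix i assume i: "i \<in> ?I"
      have "(\<integral>\<^sup>+t. A i t \<partial>lborel) =
          (if i = k then c else 1) * (\<integral>\<^sup>+t. fibre_integral (insert i S) (G i) (p t) \<partial>lborel)"
        unfolding A_def using Gp[of i] i by (intro nn_integral_cmult) auto
      also have "(\<integral>\<^sup>+t. fibre_integral (insert i S) (G i) (p t) \<partial>lborel) =
          fibre_integral (insert j (insert i S)) (G i) x"
        unfolding p_def using i j S insert.hyps by (intro fibre_integral_insert[symmetric]) auto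
      finally show "(\<integral>\<^sup>+t. A i t \<partial>lborel) =
          (if i = k then c else 1) * fibre_integral (insert i (insert j S)) (G i) x"
        by (simp add: insert_commute)
    qed
    also have "\<dots> = (\<Prod>i\<in>Basis. fibre_integral (insert i (insert j S)) (G i) x)"
      using j by (subst cc, subst (2) prod.remove[of _ j]) (auto simp: c_def)
    finally show ?case .
  qed
qed

text \<open>
  The inequality of Gagliardo, of which that of Loomis and Whitney is a variant: each factor on the
  right of the hypothesis depends on all but one of the coordinates.
\<close>

lemma nn_integral_power_le_prod_lines:
  fixes F :: "'a::euclidean_space \<Rightarrow> ennreal" and G :: "'a \<Rightarrow> 'a \<Rightarrow> ennreal"
  assumes "DIM('a) \<ge> 2"
    and [measurable]: "F \<in> borel_measurable borel"
    and [measurable]: "\<And>i. i \<in> Basis \<Longrightarrow> G i \<in> borel_measurable borel"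
    and le: "\<And>x. F x ^ (DIM('a) - 1) \<le> (\<Prod>i\<in>Basis. \<integral>\<^sup>+t. G i (x + (t - x \<bullet> i) *\<^sub>R i) \<partial>lborel)"
  shows "(\<integral>\<^sup>+x. F x \<partial>lborel) ^ (DIM('a) - 1) \<le> (\<Prod>i\<in>Basis. \<integral>\<^sup>+x. G i x \<partial>lborel)"
proof -
  have "fibre_integral {i} (G i) x = (\<integral>\<^sup>+t. G i (x + (t - x \<bullet> i) *\<^sub>R i) \<partial>lborel)" if "i \<in> Basis" for i x
    using that by (simp add: fibre_integral_insert)
  then have "fibre_integral Basis F 0 ^ (DIM('a) - 1) \<le> (\<Prod>i\<in>Basis. fibre_integral (insert i Basis) (G i) 0)"
    using assms by (intro fibre_integral_power_le) (auto cong: prod.cong)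
  also have "\<dots> = (\<Prod>i\<in>Basis. \<integral>\<^sup>+x. G i x \<partial>lborel)"
    by (intro prod.cong) (auto simp: insert_absorb fibre_integral_Basis)
  finally show ?thesis by (simp add: fibre_integral_Basis)
qed

section \<open>The Sobolev embedding at exponent one\<close>

text \<open>
  The exponent must exceed one for differentiability at zero, where the difference quotient is
  \<open>\<bar>h\<bar> powr (s - 1)\<close> up to sign.
\<close>

lemma has_real_derivative_abs_powr:
  fixes s y :: real
  assumes s: "s > 1"
  shows "((\<lambda>y. \<bar>y\<bar> powr s) has_real_derivative s * \<bar>y\<bar> powr (s - 1) * sgn y) (at y)"
proof -
  consider "y > 0" | "y < 0" | "y = 0" by linarith
  then show ?thesis
  proof cases
    case 1
    have "((\<lambda>y. y powr s) has_real_derivative s * y powr (s - 1)) (at y)"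
      using 1 by (rule has_real_derivative_powr)
    then have "((\<lambda>y. \<bar>y\<bar> powr s) has_real_derivative s * y powr (s - 1)) (at y)"
      by (rule has_field_derivative_transform_within_open[of _ _ _ "{0<..}"]) (use 1 in auto)
    then show ?thesis using 1 by simp
  next
    case 2
    have "((\<lambda>y. (- y) powr s) has_real_derivative s * (- y) powr (s - 1) * (- 1)) (at y)"
      using 2 by (auto intro!: derivative_eq_intros simp: powr_diff)
    then have "((\<lambda>y. \<bar>y\<bar> powr s) has_real_derivative s * (- y) powr (s - 1) * (- 1)) (at y)"
      by (rule has_field_derivative_transform_within_open[of _ _ _ "{..<0}"]) (use 2 in auto)
    then show ?thesis using 2 by simp
  next
    case 3
    have "((\<lambda>h. \<bar>h\<bar> powr (s - 1)) \<longlongrightarrow> \<bar>0\<bar> powr (s - 1)) (at (0::real))"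
      using s by (intro tendsto_powr' tendsto_intros) auto
    then have lim: "((\<lambda>h. \<bar>h\<bar> powr (s - 1)) \<longlongrightarrow> 0) (at (0::real))" by simp
    have "norm (\<bar>h\<bar> powr s / h) \<le> \<bar>h\<bar> powr (s - 1)" for h :: real
      by (cases "h = 0") (simp_all add: powr_diff abs_divide)
    then have "((\<lambda>h. \<bar>h\<bar> powr s / h) \<longlongrightarrow> 0) (at (0::real))"
      by (intro Lim_null_comparison[OF _ lim] eventuallyI)
    then show ?thesis using 3 by (simp add: DERIV_def)
  qed
qed

lemma continuous_on_abs_powr:
  fixes f :: "'a::topological_space \<Rightarrow> real"
  assumes "continuous_on S f" "p > 0"
  shows "continuous_on S (\<lambda>x. \<bar>f x\<bar> powr p)"
  using assms by (intro continuous_on_powr' continuous_intros) auto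

lemma continuous_on_abs_powr_sgn:
  fixes f :: "'a::topological_space \<Rightarrow> real"
  assumes f: "continuous_on S f" and p: "p > 0"
  shows "continuous_on S (\<lambda>x. \<bar>f x\<bar> powr p * sgn (f x))"
proof -
  \<comment> \<open>Splitting into positive and negative part removes the discontinuous factor \<open>sgn\<close>.\<close>
  have "\<bar>f x\<bar> powr p * sgn (f x) = max (f x) 0 powr p - max (- f x) 0 powr p" for x
    by (auto simp: sgn_if max_def)
  moreover have "continuous_on S (\<lambda>x. max (f x) 0 powr p - max (- f x) 0 powr p)"
    using f p by (intro continuous_on_diff continuous_on_powr' continuous_intros) auto
  ultimately show ?thesis by simp
qed

lemma abs_le_nn_integral_deriv:
  fixes \<phi> \<phi>' :: "real \<Rightarrow> real"
  assumes deriv: "\<And>t. (\<phi> has_real_derivative \<phi>' t) (at t)"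
    and cont: "continuous_on UNIV \<phi>'"
    and "a \<le> t" "\<phi> a = 0"
  shows "ennreal \<bar>\<phi> t\<bar> \<le> (\<integral>\<^sup>+s. ennreal \<bar>\<phi>' s\<bar> \<partial>lborel)"
proof -
  have "isCont \<phi>' x" for x using cont by (simp add: continuous_on_eq_continuous_at)
  then have b: "has_bochner_integral lborel (\<lambda>x. \<phi>' x * indicator {a..t} x) (\<phi> t - \<phi> a)"
    using assms by (intro has_bochner_integral_FTC_Icc_real) auto
  then have "ennreal (norm (\<integral>x. \<phi>' x * indicator {a..t} x \<partial>lborel))
      \<le> (\<integral>\<^sup>+x. ennreal (norm (\<phi>' x * indicator {a..t} x)) \<partial>lborel)"
    by (intro integral_norm_bound_ennreal) (rule integrable.intros)
  also have "\<dots> \<le> (\<integral>\<^sup>+s. ennreal \<bar>\<phi>' s\<bar> \<partial>lborel)"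
    by (intro nn_integral_mono) (auto split: split_indicator)
  finally show ?thesis
    using has_bochner_integral_integral_eq[OF b] assms by simp
qed

text \<open>
  On every line parallel to a coordinate axis, \<open>f\<close> vanishes far out, so \<open>\<bar>f x\<bar>\<close> is at most the integral
  of \<open>\<bar>f' b\<bar>\<close> over the line through \<open>x\<close> in direction \<open>b\<close>. The product of these \<open>d\<close> bounds
  is the hypothesis of the preceding inequality for \<open>F = \<bar>f\<bar> powr (d / (d - 1))\<close>.
\<close>

lemma gagliardo_nirenberg_sobolev:
  fixes f :: "'a::euclidean_space \<Rightarrow> real" and f' :: "'a \<Rightarrow> 'a \<Rightarrow> real"
  assumes dim: "DIM('a) \<ge> 2"
    and supp: "bounded {x. f x \<noteq> 0}"
    and contf: "continuous_on UNIV f"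
    and deriv: "\<And>b x. b \<in> Basis \<Longrightarrow> ((\<lambda>t. f (x + t *\<^sub>R b)) has_real_derivative f' b x) (at 0)"
    and cont: "\<And>b. b \<in> Basis \<Longrightarrow> continuous_on UNIV (f' b)"
  shows "(\<integral>\<^sup>+x. ennreal (\<bar>f x\<bar> powr (real DIM('a) / (real DIM('a) - 1))) \<partial>lborel) ^ (DIM('a) - 1)
    \<le> (\<Prod>b\<in>Basis. \<integral>\<^sup>+x. ennreal \<bar>f' b x\<bar> \<partial>lborel)"
proof (rule nn_integral_power_le_prod_lines[OF dim])
  have [measurable]: "f \<in> borel_measurable borel"
    using contf by (rule borel_measurable_continuous_onI)
  show "(\<lambda>x. ennreal (\<bar>f x\<bar> powr (real DIM('a) / (real DIM('a) - 1)))) \<in> borel_measurable borel"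
    by measurable
  show "(\<lambda>x. ennreal \<bar>f' b x\<bar>) \<in> borel_measurable borel" if "b \<in> Basis" for b
    using borel_measurable_continuous_onI[OF cont[OF that]] by measurable
  fix x
  obtain R where R: "\<And>y. f y \<noteq> 0 \<Longrightarrow> norm y \<le> R"
    using supp by (auto simp: bounded_iff)
  have line: "ennreal \<bar>f x\<bar> \<le> (\<integral>\<^sup>+t. ennreal \<bar>f' b (x + (t - x \<bullet> b) *\<^sub>R b)\<bar> \<partial>lborel)"
    if b: "b \<in> Basis" for b
  proof -
    define p where "p t = x + (t - x \<bullet> b) *\<^sub>R b" for t
    have d: "((\<lambda>t. f (p t)) has_real_derivative f' b (p t)) (at t)" for t
    proof -
      have "p t + h *\<^sub>R b = p (t + h)" for h
        by (simp add: p_def algebra_simps)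
      then have "((\<lambda>h. f (p (t + h))) has_real_derivative f' b (p t)) (at 0)"
        using deriv[OF b, of "p t"] by simp
      then show ?thesis by (simp add: DERIV_def)
    qed
    \<comment> \<open>The coordinate \<open>b\<close> of \<open>p a\<close> is \<open>a\<close>, so this point lies outside the ball that contains the
      support of \<open>f\<close>.\<close>
    define a where "a = min (x \<bullet> b) (- R - 1)"
    have "p a \<bullet> b = a" using b by (simp add: p_def inner_add_left inner_Basis)
    then have "\<bar>a\<bar> \<le> norm (p a)" using Basis_le_norm[OF b, of "p a"] by simp
    moreover have "\<bar>a\<bar> > R" by (auto simp: a_def)
    ultimately have "f (p a) = 0" using R[of "p a"] by fastforce
    then have "ennreal \<bar>f (p (x \<bullet> b))\<bar> \<le> (\<integral>\<^sup>+t. ennreal \<bar>f' b (p t)\<bar> \<partial>lborel)"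
      by (intro abs_le_nn_integral_deriv[where a = a] d)
        (auto simp: a_def p_def intro!: continuous_on_compose2[OF cont[OF b]] continuous_intros)
    then show ?thesis by (simp add: p_def)
  qed
  have "ennreal (\<bar>f x\<bar> powr (real DIM('a) / (real DIM('a) - 1))) ^ (DIM('a) - 1)
      = ennreal (\<bar>f x\<bar> ^ DIM('a))"
  proof (cases "f x = 0")
    case False
    have "(\<bar>f x\<bar> powr (real DIM('a) / (real DIM('a) - 1))) ^ (DIM('a) - 1) = \<bar>f x\<bar> powr real DIM('a)"
      using dim by (subst powr_realpow'[symmetric]) (auto simp: powr_powr of_nat_diff)
    then show ?thesis using False by (simp add: ennreal_power powr_realpow)
  qed (use dim in \<open>simp add: zero_power\<close>)
  also have "\<dots> = (\<Prod>b\<in>(Basis::'a set). ennreal \<bar>f x\<bar>)"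
    by (simp add: ennreal_power)
  also have "\<dots> \<le> (\<Prod>b\<in>Basis. \<integral>\<^sup>+t. ennreal \<bar>f' b (x + (t - x \<bullet> b) *\<^sub>R b)\<bar> \<partial>lborel)"
    using line by (intro prod_mono_ennreal)
  finally show "ennreal (\<bar>f x\<bar> powr (real DIM('a) / (real DIM('a) - 1))) ^ (DIM('a) - 1)
      \<le> (\<Prod>b\<in>Basis. \<integral>\<^sup>+t. ennreal \<bar>f' b (x + (t - x \<bullet> b) *\<^sub>R b)\<bar> \<partial>lborel)" .
qed

section \<open>Hoelder's inequality and continuous functions of compact support\<close>

text \<open>
  Hoelder's inequality with exponents \<open>1 / l\<close> and \<open>1 / (1 - l)\<close>. It follows from Young's inequality
  for the normalised functions, unless \<open>f\<close> or \<open>g\<close> vanishes almost everywhere.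
\<close>

lemma integral_le_powr_powr:
  fixes f g h :: "'a \<Rightarrow> real"
  assumes int: "integrable M f" "integrable M g" "integrable M h"
    and nonneg: "\<And>x. 0 \<le> f x" "\<And>x. 0 \<le> g x"
    and l: "0 < l" "l < 1"
    and le: "\<And>x. h x \<le> f x powr l * g x powr (1 - l)"
  shows "(\<integral>x. h x \<partial>M) \<le> (\<integral>x. f x \<partial>M) powr l * (\<integral>x. g x \<partial>M) powr (1 - l)"
proof -
  define a b where "a = (\<integral>x. f x \<partial>M)" and "b = (\<integral>x. g x \<partial>M)"
  have ab: "a \<ge> 0" "b \<ge> 0" using nonneg by (auto simp: a_def b_def)
  show ?thesis
  proof (cases "a = 0 \<or> b = 0")
    case True
    have "(AE x in M. f x = 0) \<or> (AE x in M. g x = 0)"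
      using True int nonneg by (auto simp: a_def b_def integral_nonneg_eq_0_iff_AE)
    moreover have "h x \<le> 0" if "f x = 0 \<or> g x = 0" for x
      using le[of x] that by auto
    ultimately have "AE x in M. h x \<le> 0" by (auto elim: AE_mp)
    then have "(\<integral>x. h x \<partial>M) \<le> (\<integral>x. 0 \<partial>M)" using int by (intro integral_mono_AE) auto
    then show ?thesis by (simp add: order_trans[OF _ mult_nonneg_nonneg])
  next
    case False
    then have pos: "a > 0" "b > 0" using ab by auto
    define K where "K = a powr l * b powr (1 - l)"
    have pt: "h x \<le> K * (l * (f x / a) + (1 - l) * (g x / b))" for x
    proof (cases "f x = 0 \<or> g x = 0")
      case True
      then have "h x \<le> 0" using le[of x] by auto
      also have "0 \<le> K * (l * (f x / a) + (1 - l) * (g x / b))"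
        using l pos nonneg[of x] by (simp add: K_def)
      finally show ?thesis .
    next
      case False
      then have fg: "f x > 0" "g x > 0" using nonneg[of x] by auto
      have "f x powr l * g x powr (1 - l) = K * ((f x / a) powr l * (g x / b) powr (1 - l))"
        using fg pos by (simp add: K_def powr_divide)
      also have "\<dots> \<le> K * (l * (f x / a) + (1 - l) * (g x / b))"
        using l fg pos by (intro mult_left_mono Youngs_inequality_0) (auto simp: K_def)
      finally show ?thesis using le[of x] by simp
    qed
    have "(\<integral>x. h x \<partial>M) \<le> (\<integral>x. K * (l * (f x / a) + (1 - l) * (g x / b)) \<partial>M)"
      using int by (intro integral_mono pt) auto
    also have "\<dots> = K * (l * (a / a) + (1 - l) * (b / b))"
      using int by (simp add: a_def b_def)
    also have "\<dots> = K" using pos by simp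
    finally show ?thesis by (simp add: K_def a_def b_def)
  qed
qed

lemma integrable_compact_support:
  fixes g :: "'a::euclidean_space \<Rightarrow> real"
  assumes "continuous_on UNIV g" "compact K" "\<And>x. x \<notin> K \<Longrightarrow> g x = 0"
  shows "integrable lborel g"
proof -
  have "integrable lborel (\<lambda>x. indicator K x *\<^sub>R g x)"
    using assms by (intro borel_integrable_compact) (auto intro: continuous_on_subset)
  also have "(\<lambda>x. indicator K x *\<^sub>R g x) = g"
    using assms(3) by (auto split: split_indicator)
  finally show ?thesis .
qed

section \<open>The weighted inequality\<close>

text \<open>
  The Sobolev embedding is applied to \<open>\<bar>u\<bar> powr s\<close>, which is again continuously differentiable
  because \<open>s > 1\<close>.
\<close>

lemma sobolev_abs_powr:
  fixes u :: "'a::euclidean_space \<Rightarrow> real" and u' :: "'a \<Rightarrow> 'a \<Rightarrow> real"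
  assumes dim: "DIM('a) \<ge> 2"
    and supp: "bounded {x. u x \<noteq> 0}"
    and contu: "continuous_on UNIV u"
    and deriv: "\<And>b x. b \<in> Basis \<Longrightarrow> ((\<lambda>t. u (x + t *\<^sub>R b)) has_real_derivative u' b x) (at 0)"
    and cont: "\<And>b. b \<in> Basis \<Longrightarrow> continuous_on UNIV (u' b)"
    and s: "s > 1"
  shows "(\<integral>\<^sup>+x. ennreal (\<bar>u x\<bar> powr (s * (real DIM('a) / (real DIM('a) - 1)))) \<partial>lborel) ^ (DIM('a) - 1)
    \<le> (\<Prod>b\<in>Basis. \<integral>\<^sup>+x. ennreal (s * (\<bar>u x\<bar> powr (s - 1) * \<bar>u' b x\<bar>)) \<partial>lborel)"
proof -
  have "(\<integral>\<^sup>+x. ennreal (\<bar>\<bar>u x\<bar> powr s\<bar> powr (real DIM('a) / (real DIM('a) - 1))) \<partial>lborel) ^ (DIM('a) - 1)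
    \<le> (\<Prod>b\<in>Basis. \<integral>\<^sup>+x. ennreal \<bar>s * (\<bar>u x\<bar> powr (s - 1) * sgn (u x)) * u' b x\<bar> \<partial>lborel)"
  proof (rule gagliardo_nirenberg_sobolev[OF dim])
    show "bounded {x. \<bar>u x\<bar> powr s \<noteq> 0}" using supp by simp
    show "continuous_on UNIV (\<lambda>x. \<bar>u x\<bar> powr s)"
      using contu s by (intro continuous_on_abs_powr) auto
    fix b :: 'a assume b: "b \<in> Basis"
    show "((\<lambda>t. \<bar>u (x + t *\<^sub>R b)\<bar> powr s) has_real_derivative
        s * (\<bar>u x\<bar> powr (s - 1) * sgn (u x)) * u' b x) (at 0)" for x
      using DERIV_chain2[OF has_real_derivative_abs_powr[OF s] deriv[OF b, of x]]
      by (simp add: mult.assoc)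
    show "continuous_on UNIV (\<lambda>x. s * (\<bar>u x\<bar> powr (s - 1) * sgn (u x)) * u' b x)"
      using s by (intro continuous_on_mult continuous_on_const continuous_on_abs_powr_sgn contu cont b) auto
  qed
  moreover have "\<bar>s * (\<bar>u x\<bar> powr (s - 1) * sgn (u x)) * u' b x\<bar> = s * (\<bar>u x\<bar> powr (s - 1) * \<bar>u' b x\<bar>)" for b x
    using s by (cases "u x = 0") (auto simp: abs_mult sgn_if)
  ultimately show ?thesis by (simp add: powr_powr)
qed

text \<open>
  The hyperboloid enters through its weight \<open>w\<close> as a continuous positive function. The functions
  \<open>u' b\<close> are the partial derivatives of \<open>u\<close>, and the dimension occurs as the real number
  \<open>D\<close>, since it serves as an exponent throughout.
\<close>

locale weighted_compact_C1 =
  fixes u :: "'a::euclidean_space \<Rightarrow> real" and u' :: "'a \<Rightarrow> 'a \<Rightarrow> real"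
    and w :: "'a \<Rightarrow> real" and K :: "'a set" and D :: real
  assumes D_eq: "D = real DIM('a)"
    and dim: "DIM('a) \<ge> 2"
    and K: "compact K"
    and u_0: "\<And>x. x \<notin> K \<Longrightarrow> u x = 0"
    and u'_0: "\<And>b x. x \<notin> K \<Longrightarrow> b \<in> Basis \<Longrightarrow> u' b x = 0"
    and u_cont: "continuous_on UNIV u"
    and u_deriv: "\<And>b x. b \<in> Basis \<Longrightarrow> ((\<lambda>t. u (x + t *\<^sub>R b)) has_real_derivative u' b x) (at 0)"
    and u'_cont: "\<And>b. b \<in> Basis \<Longrightarrow> continuous_on UNIV (u' b)"
    and w_cont: "continuous_on UNIV w"
    and w_pos: "\<And>x. w x > 0"
begin

definition moment :: "real \<Rightarrow> real \<Rightarrow> real" where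
  "moment a p = (\<integral>x. w x powr a * \<bar>u x\<bar> powr p \<partial>lborel)"

definition energy :: "real \<Rightarrow> 'a \<Rightarrow> real" where
  "energy a b = (\<integral>x. w x powr a * \<bar>u' b x\<bar> powr D \<partial>lborel)"

lemma w_powr_0: "w x powr 0 = 1"
  using w_pos[of x] by simp

lemma integrable_moment:
  assumes "p > 0"
  shows "integrable lborel (\<lambda>x. w x powr a * \<bar>u x\<bar> powr p)"
  using assms w_pos less_imp_neq[OF w_pos]
  by (intro integrable_compact_support[OF _ K] continuous_intros continuous_on_abs_powr u_cont w_cont)
    (auto simp: u_0)

lemma integrable_energy:
  assumes "b \<in> Basis"
  shows "integrable lborel (\<lambda>x. w x powr a * \<bar>u' b x\<bar> powr D)"
  using assms dim w_pos less_imp_neq[OF w_pos]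
  by (intro integrable_compact_support[OF _ K] continuous_intros continuous_on_abs_powr u'_cont w_cont)
    (auto simp: u'_0 D_eq)

lemma moment_nonneg: "moment a p \<ge> 0"
  by (simp add: moment_def)

text \<open>
  A vanishing moment forces \<open>u = 0\<close> almost everywhere, for any weight and exponent. Hence \<open>u\<close> has
  vanishing moments as soon as its energy vanishes, which the final inequality needs
  when \<open>q = r\<close>, because \<open>0 powr 0 = 0\<close>.
\<close>

lemma moment_eq_0:
  assumes "p > 0" "q > 0" "moment a p = 0"
  shows "moment b q = 0"
proof -
  have "AE x in lborel. w x powr a * \<bar>u x\<bar> powr p = 0"
    using assms integrable_moment[of p a] by (simp add: moment_def integral_nonneg_eq_0_iff_AE)
  then have "AE x in lborel. w x powr b * \<bar>u x\<bar> powr q = 0"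
    by eventually_elim (use w_pos in \<open>auto simp: less_imp_neq[OF w_pos, symmetric]\<close>)
  then show ?thesis
    unfolding moment_def by (rule integral_eq_zero_AE)
qed

text \<open>
  Sobolev's inequality for \<open>\<bar>u\<bar> powr s\<close> bounds the left-hand side by integrals of
  \<open>\<bar>u\<bar> powr (s - 1) * \<bar>u' b\<bar>\<close>. The exponent \<open>s\<close> is chosen such that
  \<open>s * D / (D - 1) = r + D / (D - 1)\<close>, which is the same as \<open>s - 1 = r * (D - 1) / D\<close>. Hoelder's
  inequality with exponents \<open>D / (D - 1)\<close> and \<open>D\<close> then produces \<open>moment \<gamma> r\<close> and the energy; the
  weights \<open>w powr \<gamma>\<close> and \<open>w powr ((1 - D) * \<gamma>)\<close> cancel in the product, so \<open>\<gamma>\<close> is arbitrary and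
  the left-hand side carries no weight.
\<close>

lemma moment_le_moment_energy:
  assumes r: "r > 0" and s: "s = 1 + r * (D - 1) / D"
  shows "moment 0 (r + D / (D - 1)) \<le> s powr (D / (D - 1)) * moment \<gamma> r
     * (\<Sum>b\<in>Basis. energy ((1 - D) * \<gamma>) b powr (1 / D)) powr (D / (D - 1))"
proof -
  define l where "l = (D - 1) / D"
  have D: "D \<ge> 2" using dim by (simp add: D_eq)
  have l: "0 < l" "l < 1" "1 - l = 1 / D" using D by (auto simp: l_def field_simps)
  have s1: "s > 1" using r D by (simp add: s)
  have s': "s - 1 = r * l" by (simp add: s l_def)
  have e: "s * (D / (D - 1)) = r + D / (D - 1)"
    using D by (simp add: s field_simps)
  have pos: "r + D / (D - 1) > 0" using r D by (intro add_pos_pos) auto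
  define A where "A = moment \<gamma> r"
  define g where "g b = energy ((1 - D) * \<gamma>) b powr (1 / D)" for b
  define G where "G = (\<Sum>b\<in>Basis. g b)"
  have A0: "A \<ge> 0" by (simp add: A_def moment_nonneg)
  have g0: "g b \<ge> 0" for b by (simp add: g_def)
  have G0: "G \<ge> 0" by (simp add: G_def g0 sum_nonneg)
  have hold: "(\<integral>x. \<bar>u x\<bar> powr (s - 1) * \<bar>u' b x\<bar> \<partial>lborel) \<le> A powr l * g b"
    and int: "integrable lborel (\<lambda>x. \<bar>u x\<bar> powr (s - 1) * \<bar>u' b x\<bar>)" if b: "b \<in> Basis" for b
  proof -
    show int: "integrable lborel (\<lambda>x. \<bar>u x\<bar> powr (s - 1) * \<bar>u' b x\<bar>)"
      using s1 by (intro integrable_compact_support[OF _ K] continuous_intros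
        continuous_on_abs_powr u_cont u'_cont b) (auto simp: u_0)
    have "\<bar>u x\<bar> powr (s - 1) * \<bar>u' b x\<bar> =
        (w x powr \<gamma> * \<bar>u x\<bar> powr r) powr l * (w x powr ((1 - D) * \<gamma>) * \<bar>u' b x\<bar> powr D) powr (1 - l)" for x
    proof -
      have "\<gamma> * l + (1 - D) * \<gamma> * (1 - l) = 0"
        using D by (simp add: l(3)) (simp add: l_def field_simps)
      then have "w x powr (\<gamma> * l) * w x powr ((1 - D) * \<gamma> * (1 - l)) = 1"
        using w_pos[of x] by (simp add: powr_add[symmetric])
      moreover have "\<bar>u' b x\<bar> powr (D * (1 - l)) = \<bar>u' b x\<bar>"
        using D by (simp add: l(3))
      ultimately show ?thesis
        by (simp add: powr_mult powr_powr s' mult_ac)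
    qed
    then have "(\<integral>x. \<bar>u x\<bar> powr (s - 1) * \<bar>u' b x\<bar> \<partial>lborel)
        \<le> (\<integral>x. w x powr \<gamma> * \<bar>u x\<bar> powr r \<partial>lborel) powr l
          * (\<integral>x. w x powr ((1 - D) * \<gamma>) * \<bar>u' b x\<bar> powr D \<partial>lborel) powr (1 - l)"
      using r b l by (intro integral_le_powr_powr integrable_moment integrable_energy int) auto
    then show "(\<integral>x. \<bar>u x\<bar> powr (s - 1) * \<bar>u' b x\<bar> \<partial>lborel) \<le> A powr l * g b"
      by (simp add: A_def moment_def g_def energy_def l(3))
  qed
  have bdd: "bounded {x. u x \<noteq> 0}"
    by (rule bounded_subset[OF compact_imp_bounded[OF K]]) (use u_0 in auto)
  have sob: "(\<integral>\<^sup>+x. ennreal (\<bar>u x\<bar> powr (s * (D / (D - 1)))) \<partial>lborel) ^ (DIM('a) - 1)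
      \<le> (\<Prod>b\<in>Basis. \<integral>\<^sup>+x. ennreal (s * (\<bar>u x\<bar> powr (s - 1) * \<bar>u' b x\<bar>)) \<partial>lborel)"
    unfolding D_eq by (rule sobolev_abs_powr[OF dim bdd u_cont u_deriv u'_cont s1])
  have "integrable lborel (\<lambda>x. \<bar>u x\<bar> powr (r + D / (D - 1)))"
    using integrable_moment[OF pos, of 0] by (simp only: w_powr_0 mult_1)
  then have "(\<integral>\<^sup>+x. ennreal (\<bar>u x\<bar> powr (r + D / (D - 1))) \<partial>lborel)
      = ennreal (\<integral>x. \<bar>u x\<bar> powr (r + D / (D - 1)) \<partial>lborel)"
    by (rule nn_integral_eq_integral) (rule AE_I2, rule powr_ge_zero)
  also have "\<dots> = ennreal (moment 0 (r + D / (D - 1)))"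
    unfolding moment_def by (simp only: w_powr_0 mult_1)
  finally have mom: "(\<integral>\<^sup>+x. ennreal (\<bar>u x\<bar> powr (r + D / (D - 1))) \<partial>lborel)
      = ennreal (moment 0 (r + D / (D - 1)))" .
  have "ennreal (moment 0 (r + D / (D - 1)) ^ (DIM('a) - 1))
      = (\<integral>\<^sup>+x. ennreal (\<bar>u x\<bar> powr (r + D / (D - 1))) \<partial>lborel) ^ (DIM('a) - 1)"
    by (simp only: mom ennreal_power[OF moment_nonneg])
  also have "\<dots> \<le> (\<Prod>b\<in>Basis. \<integral>\<^sup>+x. ennreal (s * (\<bar>u x\<bar> powr (s - 1) * \<bar>u' b x\<bar>)) \<partial>lborel)"
    by (rule sob[unfolded e])
  also have "\<dots> \<le> (\<Prod>b\<in>(Basis :: 'a set). ennreal (s * (A powr l * G)))"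
  proof (rule prod_mono_ennreal)
    fix b :: 'a assume b: "b \<in> Basis"
    have "(\<integral>\<^sup>+x. ennreal (s * (\<bar>u x\<bar> powr (s - 1) * \<bar>u' b x\<bar>)) \<partial>lborel)
        = ennreal (s * (\<integral>x. \<bar>u x\<bar> powr (s - 1) * \<bar>u' b x\<bar> \<partial>lborel))"
      using int[OF b] s1 by (subst nn_integral_eq_integral) auto
    also have "\<dots> \<le> ennreal (s * (A powr l * g b))"
      using hold[OF b] s1 by (intro ennreal_leI mult_left_mono) auto
    also have "\<dots> \<le> ennreal (s * (A powr l * G))"
      using s1 member_le_sum[OF b, of g] g0 by (intro ennreal_leI mult_left_mono) (auto simp: G_def)
    finally show "(\<integral>\<^sup>+x. ennreal (s * (\<bar>u x\<bar> powr (s - 1) * \<bar>u' b x\<bar>)) \<partial>lborel)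
        \<le> ennreal (s * (A powr l * G))" .
  qed
  also have "\<dots> = ennreal ((s * (A powr l * G)) ^ DIM('a))"
    using s1 G0 by (simp add: ennreal_power)
  finally have le: "moment 0 (r + D / (D - 1)) ^ (DIM('a) - 1) \<le> (s * (A powr l * G)) ^ DIM('a)"
    using s1 G0 by (subst (asm) ennreal_le_iff) auto
  have "moment 0 (r + D / (D - 1)) = (moment 0 (r + D / (D - 1)) ^ (DIM('a) - 1)) powr (1 / (D - 1))"
    using dim moment_nonneg by (simp add: powr_realpow'[symmetric] powr_powr of_nat_diff D_eq)
  also have "\<dots> \<le> ((s * (A powr l * G)) ^ DIM('a)) powr (1 / (D - 1))"
    using le D moment_nonneg by (intro powr_mono2) auto
  also have "\<dots> = (s * (A powr l * G)) powr (D / (D - 1))"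
    using s1 G0 by (simp add: powr_realpow'[symmetric] powr_powr D_eq)
  also have "\<dots> = s powr (D / (D - 1)) * A powr (l * (D / (D - 1))) * G powr (D / (D - 1))"
    by (simp add: powr_mult powr_powr)
  also have "l * (D / (D - 1)) = 1" using D by (simp add: l_def)
  finally show ?thesis using A0 by (simp add: A_def G_def g_def)
qed

text \<open>
  Interpolation between a weighted and an unweighted moment: the whole weight comes from the
  first factor.
\<close>

lemma moment_interpolation:
  assumes r: "r > 0" "q > 0" "p > 0"
    and l: "0 < l" "l < 1" "l * q + (1 - l) * p = r"
  shows "moment (\<beta> * (l * q)) r \<le> moment (\<beta> * q) q powr l * moment 0 p powr (1 - l)"
  unfolding moment_def
proof (rule integral_le_powr_powr)
  show "w x powr (\<beta> * (l * q)) * \<bar>u x\<bar> powr r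
      \<le> (w x powr (\<beta> * q) * \<bar>u x\<bar> powr q) powr l * (w x powr 0 * \<bar>u x\<bar> powr p) powr (1 - l)" for x
  proof -
    have "\<bar>u x\<bar> powr r = \<bar>u x\<bar> powr (q * l) * \<bar>u x\<bar> powr (p * (1 - l))"
      using l(3) by (simp add: powr_add[symmetric] mult.commute)
    then show ?thesis using w_pos[of x] by (simp add: powr_mult powr_powr mult_ac)
  qed
  show "integrable lborel (\<lambda>x. w x powr 0 * \<bar>u x\<bar> powr p)"
    by (rule integrable_moment[OF \<open>p > 0\<close>])
qed (use assms in \<open>auto intro!: integrable_moment\<close>)

text \<open>
  Write \<open>A\<close> for the moment on the left, \<open>B\<close> for that on the right, \<open>G\<close> for the sum, \<open>\<sigma> = D / (D - 1)\<close> and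
  \<open>k = s powr \<sigma>\<close>. The two preceding inequalities give \<open>A \<le> B powr l * (k * A * G powr \<sigma>) powr (1 - l)\<close>.
  The integral \<open>A\<close> is finite, so its power on the right can be absorbed on the left, and the equation for
  \<open>\<theta>\<close> says that the remaining exponent \<open>\<sigma> * (1 - l) / l\<close> of \<open>G\<close> is \<open>r - q\<close>.
\<close>

lemma weighted_gagliardo_nirenberg:
  fixes q r \<beta> \<theta> s :: real
  assumes q: "1 \<le> q" "q \<le> r" and \<theta>: "0 < \<theta>" "\<theta> \<le> 1"
    and eq: "1 / r = \<theta> / q + (1 - \<theta>) / (r + D / (D - 1))"
    and s: "s = 1 + r * (D - 1) / D"
    and l: "l = \<theta> * r / q"
  shows "moment (\<theta> * \<beta> * r) r \<le> (s powr (D / (D - 1))) powr ((1 - l) / l) * moment (\<beta> * q) q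
     * (\<Sum>b\<in>Basis. energy ((1 - D) * (\<theta> * \<beta> * r)) b powr (1 / D)) powr (r - q)"
proof -
  have D: "D \<ge> 2" using dim by (simp add: D_eq)
  define \<sigma> where "\<sigma> = D / (D - 1)"
  have \<sigma>: "\<sigma> > 0" using D by (simp add: \<sigma>_def)
  have pos: "r > 0" "q > 0" "r + \<sigma> > 0" using q \<sigma> by auto
  define A where "A = moment (\<theta> * \<beta> * r) r"
  define B where "B = moment (\<beta> * q) q"
  define G where "G = (\<Sum>b\<in>Basis. energy ((1 - D) * (\<theta> * \<beta> * r)) b powr (1 / D))"
  define k where "k = s powr \<sigma>"
  have s0: "s > 1" using pos D by (simp add: s)
  have k: "k > 0" using s0 by (simp add: k_def)
  have nonneg: "A \<ge> 0" "B \<ge> 0" "G \<ge> 0"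
    by (auto simp: A_def B_def G_def moment_nonneg sum_nonneg)
  have sob: "moment 0 (r + \<sigma>) \<le> k * A * G powr \<sigma>"
    using moment_le_moment_energy[OF pos(1) s, of "\<theta> * \<beta> * r"] by (simp add: \<sigma>_def k_def A_def G_def)
  have l0: "l > 0" using \<theta> pos by (simp add: l)
  have eq': "1 = \<theta> * r / q + (1 - \<theta>) * r / (r + \<sigma>)"
    using arg_cong[OF eq, of "\<lambda>x. x * r"] pos by (simp add: \<sigma>_def algebra_simps)
  then have ml: "1 - l = (1 - \<theta>) * r / (r + \<sigma>)" by (simp add: l)
  have bal: "l * q + (1 - l) * (r + \<sigma>) = r"
  proof -
    have "l * q = \<theta> * r" using pos by (simp add: l)
    moreover have "(1 - l) * (r + \<sigma>) = (1 - \<theta>) * r" using pos by (simp add: ml)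
    ultimately show ?thesis by (simp add: algebra_simps)
  qed
  have "A \<le> k powr ((1 - l) / l) * B * G powr (r - q)"
  proof (cases "A = 0")
    case True
    then show ?thesis using nonneg by simp
  next
    case False
    then have A: "A > 0" using nonneg by simp
    \<comment> \<open>For \<open>q = r\<close> the last factor of the claim has to be \<open>G powr 0 = 1\<close>, which fails for \<open>G = 0\<close>.\<close>
    have G: "G > 0"
    proof (rule ccontr)
      assume "\<not> G > 0"
      then have "G = 0" using nonneg by simp
      then have "moment 0 (r + \<sigma>) = 0" using sob moment_nonneg[of 0 "r + \<sigma>"] by simp
      then have "A = 0" unfolding A_def by (rule moment_eq_0[OF pos(3) pos(1)])
      then show False using A by simp
    qed
    show ?thesis
    proof (cases "\<theta> = 1")
      case True
      then have "q = r" using eq pos by simp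
      then show ?thesis using True G k l pos by (simp add: A_def B_def)
    next
      case False
      then have l1: "l < 1" using \<theta> pos ml
        by (smt (verit) divide_pos_pos mult_pos_pos)
      have "A \<le> B powr l * moment 0 (r + \<sigma>) powr (1 - l)"
        using moment_interpolation[OF pos(1,2,3) l0 l1 bal, of \<beta>] pos
        by (simp add: A_def B_def l mult_ac)
      also have "\<dots> \<le> B powr l * (k * A * G powr \<sigma>) powr (1 - l)"
        using sob l1 moment_nonneg by (intro mult_left_mono powr_mono2) auto
      also have "\<dots> = B powr l * (k powr (1 - l) * G powr (\<sigma> * (1 - l))) * A powr (1 - l)"
        by (simp add: powr_mult powr_powr mult_ac)
      finally have "A / A powr (1 - l) \<le> B powr l * (k powr (1 - l) * G powr (\<sigma> * (1 - l)))"
        using A by (simp add: divide_le_eq)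
      moreover have "A / A powr (1 - l) = A powr l"
        using A by (simp add: powr_diff)
      ultimately have "A powr l \<le> B powr l * (k powr (1 - l) * G powr (\<sigma> * (1 - l)))" by simp
      then have "(A powr l) powr (1 / l) \<le> (B powr l * (k powr (1 - l) * G powr (\<sigma> * (1 - l)))) powr (1 / l)"
        using l0 by (intro powr_mono2) auto
      also have "\<dots> = B * (k powr ((1 - l) / l) * G powr (\<sigma> * (1 - l) / l))"
        using l0 nonneg by (simp add: powr_mult powr_powr)
      also have "\<sigma> * (1 - l) / l = r - q"
        using bal l0 by (simp add: field_simps)
      finally show ?thesis using A l0 by (simp add: powr_powr mult_ac)
    qed
  qed
  then show ?thesis by (simp add: A_def B_def G_def k_def \<sigma>_def)
qed

end

section \<open>Norms on the hyperboloid as integrals over Euclidean space\<close>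

lemma hyp_w_pos: "\<tau> > 0 \<Longrightarrow> hyp_w \<tau> x > 0"
  unfolding hyp_w_def by (intro real_sqrt_gt_zero add_pos_nonneg) auto

lemma continuous_on_hyp_w: "continuous_on S (hyp_w \<tau>)"
  unfolding hyp_w_def[abs_def] by (intro continuous_intros)

lemma Lp_norm_eq_lborel:
  fixes u :: "real ^ 'n::finite \<Rightarrow> real"
  assumes \<tau>: "\<tau> > 0" and u: "continuous_on UNIV u"
  shows "Lp_norm \<tau> p \<alpha> u = (\<tau> * (\<integral>x. hyp_w \<tau> x powr (\<alpha> - 1) * \<bar>u x\<bar> powr p \<partial>lborel)) powr (1 / p)"
proof -
  have [measurable]: "u \<in> borel_measurable borel" "hyp_w \<tau> \<in> borel_measurable borel"
    using u continuous_on_hyp_w by (auto intro: borel_measurable_continuous_onI)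
  have "(\<integral>x. hyp_w \<tau> x powr \<alpha> * \<bar>u x\<bar> powr p \<partial>hyp_vol \<tau>)
      = (\<integral>x. (\<tau> / hyp_w \<tau> x) *\<^sub>R (hyp_w \<tau> x powr \<alpha> * \<bar>u x\<bar> powr p) \<partial>lborel)"
    unfolding hyp_vol_def using less_imp_le[OF hyp_w_pos[OF \<tau>]] \<tau>
    by (intro integral_density) (auto intro!: AE_I2 divide_nonneg_nonneg)
  also have "\<dots> = (\<integral>x. \<tau> * (hyp_w \<tau> x powr (\<alpha> - 1) * \<bar>u x\<bar> powr p) \<partial>lborel)"
  proof (rule Bochner_Integration.integral_cong[OF refl])
    fix x
    show "(\<tau> / hyp_w \<tau> x) *\<^sub>R (hyp_w \<tau> x powr \<alpha> * \<bar>u x\<bar> powr p)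
        = \<tau> * (hyp_w \<tau> x powr (\<alpha> - 1) * \<bar>u x\<bar> powr p)"
      using hyp_w_pos[OF \<tau>, of x] by (simp add: powr_diff)
  qed
  finally show ?thesis by (simp add: Lp_norm_def)
qed

text \<open>
  The boost contributes one factor \<open>w\<^sub>\<tau>\<close>, hence \<open>p\<close> to the exponent of the weight, and the volume
  form contributes \<open>-1\<close>.
\<close>

lemma Lp_norm_boost_eq_lborel:
  fixes u :: "real ^ 'n::finite \<Rightarrow> real"
  assumes \<tau>: "\<tau> > 0" and u: "continuous_on UNIV (partial_deriv i u)"
  shows "Lp_norm \<tau> p \<alpha> (boost \<tau> i u) =
    (\<tau> * (\<integral>x. hyp_w \<tau> x powr (\<alpha> + p - 1) * \<bar>partial_deriv i u x\<bar> powr p \<partial>lborel)) powr (1 / p)"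
proof -
  have "continuous_on UNIV (boost \<tau> i u)"
    unfolding boost_def[abs_def] by (intro continuous_intros continuous_on_hyp_w u)
  moreover have "hyp_w \<tau> x powr (\<alpha> - 1) * \<bar>boost \<tau> i u x\<bar> powr p
      = hyp_w \<tau> x powr (\<alpha> + p - 1) * \<bar>partial_deriv i u x\<bar> powr p" for x
  proof -
    have "hyp_w \<tau> x powr (\<alpha> - 1) * hyp_w \<tau> x powr p = hyp_w \<tau> x powr (\<alpha> + p - 1)"
      by (simp add: powr_add[symmetric] algebra_simps)
    then show ?thesis
      using hyp_w_pos[OF \<tau>, of x] by (simp add: boost_def abs_mult powr_mult)
  qed
  ultimately show ?thesis using \<tau> by (simp add: Lp_norm_eq_lborel)
qed

lemma W_norm_1:
  fixes u :: "real ^ 'n::finite \<Rightarrow> real"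
  shows "W_norm \<tau> 1 p \<alpha> u = (\<Sum>i\<in>UNIV. Lp_norm \<tau> p \<alpha> (boost \<tau> i u))"
proof -
  have "{I :: 'n list. length I = 1} = (\<lambda>i. [i]) ` UNIV"
    by (auto simp: length_Suc_conv)
  then show ?thesis
    by (simp add: W_norm_def sum.reindex inj_on_def)
qed

lemma Basis_vec_eq_range_axis: "(Basis :: (real ^ 'n::finite) set) = range (\<lambda>i. axis i 1)"
  by (auto simp: Basis_vec_def)

lemma sum_Basis_vec: "(\<Sum>b\<in>(Basis :: (real ^ 'n::finite) set). f b) = (\<Sum>i\<in>UNIV. f (axis i 1))"
  by (simp add: Basis_vec_eq_range_axis sum.reindex inj_on_def axis_eq_axis)

lemma weighted_compact_C1_smooth:
  fixes u :: "real ^ 'n::finite \<Rightarrow> real"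
  assumes card: "CARD('n) \<ge> 2" and \<tau>: "\<tau> > 0" and "smooth u" and comp: "compactly_supported u"
  shows "weighted_compact_C1 u (\<lambda>b x. frechet_derivative u (at x) b) (hyp_w \<tau>)
    (closure {x. u x \<noteq> 0}) (real CARD('n))"
proof
  let ?K = "closure {x. u x \<noteq> 0}"
  have "C_k (Suc 0) u" using \<open>smooth u\<close> unfolding smooth_def by blast
  then have diff: "u differentiable (at x)" and cont: "continuous_on UNIV (partial_deriv i u)" for x i
    by auto
  show zero: "u x = 0" if "x \<notin> ?K" for x
    using that closure_subset[of "{x. u x \<noteq> 0}"] by blast
  show "frechet_derivative u (at x) b = 0" if "x \<notin> ?K" for x b
  proof -
    have "(u has_derivative (\<lambda>_. 0)) (at x)"
    proof (rule has_derivative_transform_within_open[OF has_derivative_const])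
      show "open (- ?K)" by (rule open_Compl) (rule closed_closure)
      show "x \<in> - ?K" using that by simp
      show "0 = u y" if "y \<in> - ?K" for y
        by (rule zero[symmetric]) (use that in blast)
    qed
    from frechet_derivative_at[OF this, symmetric] show ?thesis by simp
  qed
  show "continuous_on UNIV u"
    using differentiable_imp_continuous_within[OF diff] by (simp add: continuous_at_imp_continuous_on)
  show "((\<lambda>t. u (x + t *\<^sub>R b)) has_real_derivative frechet_derivative u (at x) b) (at 0)" for b x
  proof -
    have "(u has_derivative frechet_derivative u (at x)) (at (x + 0 *\<^sub>R b))"
      using diff frechet_derivative_works by auto
    moreover have "((\<lambda>t::real. x + t *\<^sub>R b) has_derivative (\<lambda>t. t *\<^sub>R b)) (at 0)"
      by (auto intro!: derivative_eq_intros)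
    ultimately have "((\<lambda>t. u (x + t *\<^sub>R b)) has_derivative (\<lambda>t. frechet_derivative u (at x) (t *\<^sub>R b))) (at 0)"
      by (rule has_derivative_compose[rotated])
    moreover have "(\<lambda>t. frechet_derivative u (at x) (t *\<^sub>R b)) = (*) (frechet_derivative u (at x) b)"
      using linear_frechet_derivative[OF diff] by (simp add: fun_eq_iff linear_cmul)
    ultimately show ?thesis
      by (simp add: has_field_derivative_def)
  qed
  show "continuous_on UNIV (\<lambda>x. frechet_derivative u (at x) b)" if "b \<in> Basis" for b
    using that cont by (auto simp: Basis_vec_eq_range_axis partial_deriv_def[abs_def])
qed (use card comp hyp_w_pos[OF \<tau>] continuous_on_hyp_w in \<open>auto simp: compactly_supported_def\<close>)

section \<open>The Gagliardo-Nirenberg inequality on hyperboloids\<close>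

theorem proposition2p4:
  fixes q r \<beta> \<theta> d one_star :: real
  assumes "d = real CARD('n::finite)"
    and "CARD('n) \<ge> 2"
    and "one_star = d / (d - 1)"
    and "1 \<le> q" and "q \<le> r"
    and "0 < \<theta>" and "\<theta> \<le> 1"
    and "1 / r = \<theta> / q + (1 - \<theta>) / (r + one_star)"
  shows "\<exists>C::real. \<forall>\<tau>>0. \<forall>u :: real ^ 'n \<Rightarrow> real.
    smooth u \<and> compactly_supported u \<longrightarrow>
      (\<tau> powr (1 / d)) powr ((r - q) / r) * Lp_norm \<tau> r (1 + \<theta> * \<beta> * r) u
      \<le> C * Lp_norm \<tau> q (1 + \<beta> * q) u powr (q / r)
          * W_norm \<tau> 1 d ((1 - d) * (1 + \<beta> * \<theta> * r)) u powr ((r - q) / r)"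
proof -
  define l where "l = \<theta> * r / q"
  define s where "s = 1 + r * (d - 1) / d"
  define k where "k = (s powr (d / (d - 1))) powr ((1 - l) / l)"
  have pos: "q > 0" "r > 0" "d \<ge> 2" using assms by auto
  show ?thesis
  proof (intro exI[of _ "k powr (1 / r)"] allI impI)
    fix \<tau> :: real and u :: "real ^ 'n \<Rightarrow> real"
    assume \<tau>: "\<tau> > 0" and u: "smooth u \<and> compactly_supported u"
    define u' where "u' = (\<lambda>b x. frechet_derivative u (at x) b)"
    interpret weighted_compact_C1 u u' "hyp_w \<tau>" "closure {x. u x \<noteq> 0}" d
      using weighted_compact_C1_smooth[OF assms(2) \<tau>] u by (simp add: u'_def assms(1))
    have pd: "partial_deriv i u x = u' (axis i 1) x" for i x
      by (simp add: u'_def partial_deriv_def)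
    define A where "A = moment (\<theta> * \<beta> * r) r"
    define B where "B = moment (\<beta> * q) q"
    define G where "G = (\<Sum>b\<in>Basis. energy ((1 - d) * (\<theta> * \<beta> * r)) b powr (1 / d))"
    have nonneg: "A \<ge> 0" "B \<ge> 0" "G \<ge> 0" "k \<ge> 0"
      by (auto simp: A_def B_def G_def k_def moment_nonneg sum_nonneg)
    have main: "A \<le> k * B * G powr (r - q)"
      using weighted_gagliardo_nirenberg[OF assms(4-7) assms(8)[unfolded assms(3)] s_def l_def, of \<beta>]
      by (simp add: A_def B_def G_def k_def)
    \<comment> \<open>With the exponents \<open>q / r\<close> and \<open>(r - q) / r\<close> of the claim, the powers of \<open>\<tau>\<close> in these three
      norms are the same on both sides.\<close>
    have normA: "Lp_norm \<tau> r (1 + \<theta> * \<beta> * r) u = (\<tau> * A) powr (1 / r)"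
      using \<tau> u_cont by (simp add: Lp_norm_eq_lborel A_def moment_def)
    have normB: "Lp_norm \<tau> q (1 + \<beta> * q) u = (\<tau> * B) powr (1 / q)"
      using \<tau> u_cont by (simp add: Lp_norm_eq_lborel B_def moment_def)
    have normG: "W_norm \<tau> 1 d ((1 - d) * (1 + \<beta> * \<theta> * r)) u = \<tau> powr (1 / d) * G"
    proof -
      have e: "(1 - d) * (1 + \<beta> * \<theta> * r) + d - 1 = (1 - d) * (\<theta> * \<beta> * r)"
        by (simp add: algebra_simps)
      have "Lp_norm \<tau> d ((1 - d) * (1 + \<beta> * \<theta> * r)) (boost \<tau> i u)
          = \<tau> powr (1 / d) * energy ((1 - d) * (\<theta> * \<beta> * r)) (axis i 1) powr (1 / d)" for i
      proof -
        have "continuous_on UNIV (partial_deriv i u)"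
          using u'_cont[of "axis i 1"] by (simp add: pd[abs_def] Basis_vec_eq_range_axis)
        from Lp_norm_boost_eq_lborel[OF \<tau> this, of d "(1 - d) * (1 + \<beta> * \<theta> * r)"]
        show ?thesis by (simp add: e pd energy_def powr_mult)
      qed
      then show ?thesis
        by (simp only: W_norm_1 G_def sum_Basis_vec sum_distrib_left)
    qed
    define g where "g = (\<tau> powr (1 / d)) powr ((r - q) / r)"
    have "g * (\<tau> * A) powr (1 / r) = g * \<tau> powr (1 / r) * A powr (1 / r)"
      by (simp add: powr_mult)
    also have "\<dots> \<le> g * \<tau> powr (1 / r) * (k * B * G powr (r - q)) powr (1 / r)"
      using main nonneg pos by (intro mult_left_mono powr_mono2) (auto simp: g_def)
    also have "\<dots> = k powr (1 / r) * ((\<tau> * B) powr (1 / q)) powr (q / r)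
        * (\<tau> powr (1 / d) * G) powr ((r - q) / r)"
      using pos by (simp add: g_def powr_mult powr_powr mult_ac)
    finally show "(\<tau> powr (1 / d)) powr ((r - q) / r) * Lp_norm \<tau> r (1 + \<theta> * \<beta> * r) u
      \<le> k powr (1 / r) * Lp_norm \<tau> q (1 + \<beta> * q) u powr (q / r)
          * W_norm \<tau> 1 d ((1 - d) * (1 + \<beta> * \<theta> * r)) u powr ((r - q) / r)"
      unfolding normA normB normG g_def .
  qed
qed

end
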